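(* Let $d\ge 1$, $m>1$, $m^\ast:=m/(m-1)$, and let $(b,V)$ satisfy the structural assumptions listed in the context with constants $\delta>0$, $\rho>0$, $R>0$, $a\in\mathbf{R}$, $\eta>0$. Then $$\lim_{\beta\to\infty}\beta^{-\frac{\delta m^\ast}{\delta m^\ast+\eta}}\,\lambda_{\max}(\beta)=\left(\frac{\delta m^\ast+\eta}{\delta m^\ast}\right)\left(\frac{\rho^{m^\ast}\delta}{\eta}\right)^{\frac{\eta}{\delta m^\ast+\eta}}.$$
   Context: For $r>0$, $B_r:=\{x\in\mathbf{R}^d : |x|<r\}$, and $\overline{B}_r$ is its closure. $D\phi$ and $\Delta\phi$ denote the gradient and Laplacian of $\phi$. For $\beta\ge 0$ consider the equation $$\text{(EP)}\qquad \lambda-\Delta\phi(x)+b(x)\cdot D\phi(x)+\frac1m|D\phi(x)|^m-\beta V(x)=0,\qquad x\in\mathbf{R}^d.$$ A pair $(\lambda,\phi)\in\mathbf{R}\times C^3(\mathbf{R}^d)$ is a subsolution of (EP) if the left-hand side is $\le 0$ for every $x\in\mathbf{R}^d$. The generalized principal eigenvalue is $$\lambda_{\max}(\beta):=\sup\{\lambda\in\mathbf{R} : \text{(EP) has a subsolution } (\lambda,\phi)\in\mathbf{R}\times C^3(\mathbf{R}^d)\}.$$ Structural assumptions on $(b,V)$: $b\in C^2(\mathbf{R}^d,\mathbf{R}^d)$, $V\in C^2(\mathbf{R}^d)$, $DV\in L^\infty(\mathbf{R}^d,\mathbf{R}^d)$, and - $b(x)=(\rho+a|x|^{-1})|x|^{\delta-1}x$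 for all $x\notin B_R$; - $V(x)\ge 0$ for all $x\in\mathbf{R}^d$, $V(x)>0$ for all $x\in\overline{B}_R$, and $V(x)=|x|^{-\eta}$ for all $x\notin B_R$. *)

theory Defs
  imports "HOL-Analysis.Analysis"
begin

(* Ck k f: f is of class C^k on the whole space; in finite dimension, continuity of all iterated
   directional derivatives up to order k is the usual notion. *)
primrec Ck :: "nat \<Rightarrow> ('a::euclidean_space \<Rightarrow> 'b::euclidean_space) \<Rightarrow> bool" where
  "Ck 0 f \<longleftrightarrow> continuous_on UNIV f"
| "Ck (Suc k) f \<longleftrightarrow>
     (\<forall>x. f differentiable (at x)) \<and> (\<forall>v. Ck k (\<lambda>x. frechet_derivative f (at x) v))"

definition partial_deriv :: "'d \<Rightarrow> (real^'d \<Rightarrow> real) \<Rightarrow> real^'d::finite \<Rightarrow> real" where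
  "partial_deriv i f x = frechet_derivative f (at x) (axis i 1)"

definition gradient :: "(real^'d::finite \<Rightarrow> real) \<Rightarrow> real^'d \<Rightarrow> real^'d" where
  "gradient f x = (\<chi> i. partial_deriv i f x)"

definition laplacian :: "(real^'d::finite \<Rightarrow> real) \<Rightarrow> real^'d \<Rightarrow> real" where
  "laplacian f x = (\<Sum>i\<in>UNIV. partial_deriv i (partial_deriv i f) x)"

lemma gradient_gderiv:
  fixes f :: "real^'d::finite \<Rightarrow> real"
  assumes "f differentiable (at x)"
  shows "GDERIV f x :> gradient f x"
proof -
  let ?f' = "frechet_derivative f (at x)"
  have f': "(f has_derivative ?f') (at x)"
    using assms frechet_derivative_works by blast
  then interpret linear ?f'
    by (rule has_derivative_linear)
  have "?f' h = h \<bullet> gradient f x" for h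
  proof -
    have "?f' h = ?f' (\<Sum>i\<in>UNIV. h $ i *\<^sub>R axis i 1)"
      using basis_expansion[of h] by (simp add: scalar_mult_eq_scaleR)
    also have "\<dots> = (\<Sum>i\<in>UNIV. h $ i * partial_deriv i f x)"
      by (simp add: sum scale partial_deriv_def)
    finally show ?thesis
      by (simp add: inner_vec_def gradient_def)
  qed
  then have "?f' = (\<lambda>h. h \<bullet> gradient f x)"
    by (rule ext)
  with f' show ?thesis
    unfolding gderiv_def by simp
qed

definition L_infinity :: "('a::euclidean_space \<Rightarrow> 'b::euclidean_space) \<Rightarrow> bool" where
  "L_infinity f \<longleftrightarrow>
     f \<in> borel_measurable lebesgue \<and> (\<exists>C. AE x in lebesgue. norm (f x) \<le> C)"

definition structural_assumptions ::
  "real \<Rightarrow> real \<Rightarrow> real \<Rightarrow> real \<Rightarrow> real \<Rightarrow>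
     (real^'d::finite \<Rightarrow> real^'d) \<Rightarrow> (real^'d \<Rightarrow> real) \<Rightarrow> bool" where
  "structural_assumptions \<delta> \<rho> R a \<eta> b V \<longleftrightarrow>
     Ck 2 b \<and> Ck 2 V \<and> L_infinity (gradient V) \<and>
     (\<forall>x. x \<notin> ball 0 R \<longrightarrow> b x = ((\<rho> + a * inverse (norm x)) * norm x powr (\<delta> - 1)) *\<^sub>R x) \<and>
     (\<forall>x. V x \<ge> 0) \<and>
     (\<forall>x\<in>cball 0 R. V x > 0) \<and>
     (\<forall>x. x \<notin> ball 0 R \<longrightarrow> V x = norm x powr (- \<eta>))"

definition EP_lhs ::
  "real \<Rightarrow> (real^'d::finite \<Rightarrow> real^'d) \<Rightarrow> (real^'d \<Rightarrow> real) \<Rightarrow> real \<Rightarrow>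
     real \<Rightarrow> (real^'d \<Rightarrow> real) \<Rightarrow> real^'d \<Rightarrow> real" where
  "EP_lhs m b V \<beta> \<mu> \<phi> x =
     \<mu> - laplacian \<phi> x + b x \<bullet> gradient \<phi> x + (1 / m) * norm (gradient \<phi> x) powr m - \<beta> * V x"

definition EP_subsolution ::
  "real \<Rightarrow> (real^'d::finite \<Rightarrow> real^'d) \<Rightarrow> (real^'d \<Rightarrow> real) \<Rightarrow> real \<Rightarrow>
     real \<Rightarrow> (real^'d \<Rightarrow> real) \<Rightarrow> bool" where
  "EP_subsolution m b V \<beta> \<mu> \<phi> \<longleftrightarrow> Ck 3 \<phi> \<and> (\<forall>x. EP_lhs m b V \<beta> \<mu> \<phi> x \<le> 0)"

(* The supremum is taken in the extended reals, as Sup on type real is unspecified for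
   sets that are empty or unbounded above. *)
definition lambda_max ::
  "real \<Rightarrow> (real^'d::finite \<Rightarrow> real^'d) \<Rightarrow> (real^'d \<Rightarrow> real) \<Rightarrow> real \<Rightarrow> ereal" where
  "lambda_max m b V \<beta> = Sup {ereal \<mu> | \<mu>. \<exists>\<phi>. EP_subsolution m b V \<beta> \<mu> \<phi>}"

end

theory Submission
  imports Defs
begin

text \<open>
  Put \<open>p = \<delta> ms\<close> and \<open>K = \<rho>\<^sup>m\<^sup>s / ms\<close>. By Young's inequality
  \<open>b \<bullet> q + |q|\<^sup>m / m \<ge> - |b|\<^sup>m\<^sup>s / ms\<close> for every vector \<open>q\<close>, with equality for one \<open>q\<close> directed against \<open>b\<close>, and
  \<open>|b|\<^sup>m\<^sup>s / ms\<close> is asymptotic to \<open>K |x|\<^sup>p\<close>. If the Laplacian could be ignored, the largest admissible level would be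
  the minimum over \<open>t = |x|\<close> of the effective potential \<open>K t powr p + \<beta> t powr (-\<eta>)\<close>. The minimiser
  \<open>r\<close> satisfies \<open>\<beta> = B r powr (p + \<eta>)\<close> with \<open>B = K p / \<eta>\<close>, and the minimum \<open>(K + B) r powr p\<close> is the
  claimed limit times \<open>\<beta> powr (p / (p + \<eta>))\<close>. As \<open>\<beta>\<close> tends to infinity so does \<open>r\<close>, and the
  Laplacian becomes negligible; everything is therefore expressed in terms of \<open>r\<close>.

  Lower bound (\<open>exists_near_optimal_subsolution\<close>): a multiple of \<open>(1 + |x|\<^sup>2)\<^sup>s\<close> has a gradient
  asymptotic to the optimal \<open>q\<close>. For large \<open>\<beta>\<close> it is a subsolution for any level below the minimum by a
  fixed factor, since far out the limit \<open>radial_operator_limit\<close> applies and near the origin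
  \<open>\<beta> V\<close> dominates.

  Upper bound (\<open>subsolution_level_upper_bound\<close>): inside a cube of fixed size centred at distance \<open>r\<close> from
  the origin, an arbitrary subsolution is touched from above, up to an additive
  constant, by a barrier that blows up on the boundary of the cube. At the touching point the maximum principle, together with the superlinear
  growth of \<open>|D\<phi>|\<^sup>m\<close>, bounds the level by the effective potential plus a constant that does not depend
  on \<open>\<beta>\<close> or on the subsolution (\<open>subsolution_local_bound\<close>).
\<close>

section \<open>Smooth functions and powers of \<open>1 + |x|\<^sup>2\<close>\<close>

lemma Ck_Suc_imp_Ck: "Ck (Suc k) f \<Longrightarrow> Ck k f"
proof (induction k arbitrary: f)
  case 0
  then show ?case
    by (auto intro!: continuous_at_imp_continuous_on differentiable_imp_continuous_within)
qed auto

lemma Ck_imp_continuous: "Ck k f \<Longrightarrow> continuous_on UNIV f"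
proof (induction k)
  case (Suc k)
  then show ?case using Ck_Suc_imp_Ck by blast
qed simp

lemma Ck_const: "Ck k (\<lambda>x. c)"
  by (induction k arbitrary: c) simp_all

text \<open>
  The recursive clause of \<^const>\<open>Ck\<close> refers to the chosen derivative
  \<^const>\<open>frechet_derivative\<close>; this introduction rule accepts any explicit formula for it.
\<close>

lemma Ck_SucI:
  assumes "\<And>x. (f has_derivative D x) (at x)" and "\<And>v. Ck k (\<lambda>x. D x v)"
  shows "Ck (Suc k) f"
proof -
  have "frechet_derivative f (at x) = D x" for x
    using frechet_derivative_at[OF assms(1)] by simp
  with assms show ?thesis
    by (auto simp: differentiable_def)
qed

lemma Ck_inner: "Ck k (\<lambda>x::'a::euclidean_space. v \<bullet> x)"
proof (cases k)
  case (Suc j)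
  have "((\<bullet>) v has_derivative (\<bullet>) v) (at x)" for x :: 'a
    by (auto intro!: derivative_eq_intros)
  from Ck_SucI[OF this Ck_const] Suc show ?thesis by simp
qed (auto intro!: continuous_intros)

lemma Ck_add:
  fixes f g :: "'a::euclidean_space \<Rightarrow> real"
  assumes "Ck k f" "Ck k g"
  shows "Ck k (\<lambda>x. f x + g x)"
  using assms
proof (induction k arbitrary: f g)
  case 0
  then show ?case by (auto intro!: continuous_intros)
next
  case (Suc k)
  then show ?case
    by (intro Ck_SucI[where D = "\<lambda>x v. frechet_derivative f (at x) v + frechet_derivative g (at x) v"])
       (auto intro!: has_derivative_add simp: frechet_derivative_works)
qed

lemma Ck_mult:
  fixes f g :: "'a::euclidean_space \<Rightarrow> real"
  assumes "Ck k f" "Ck k g"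
  shows "Ck k (\<lambda>x. f x * g x)"
  using assms
proof (induction k arbitrary: f g)
  case 0
  then show ?case by (auto intro!: continuous_intros)
next
  case (Suc k)
  from Suc.prems have fg: "Ck k f" "Ck k g"
    by (auto intro: Ck_Suc_imp_Ck)
  show ?case
  proof (rule Ck_SucI)
    show "((\<lambda>x. f x * g x) has_derivative
        (\<lambda>v. f x * frechet_derivative g (at x) v + frechet_derivative f (at x) v * g x)) (at x)" for x
      using Suc.prems by (intro has_derivative_mult) (auto simp: frechet_derivative_works)
    show "Ck k (\<lambda>x. f x * frechet_derivative g (at x) v + frechet_derivative f (at x) v * g x)" for v
      using Suc.prems fg by (intro Ck_add Suc.IH) auto
  qed
qed

text \<open>
  The functions \<open>(1 + |x|\<^sup>2)\<^sup>s\<close> behave like \<open>|x|\<^sup>2\<^sup>s\<close> at infinity but have no singularity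
  at the origin. Differentiation lowers the exponent by one and multiplies by a linear function,
  so the family stays within products of itself with linear functions: this gives smoothness of
  every order, and closed forms for gradient and Laplacian.
\<close>

lemma has_derivative_bracket_powr:
  "((\<lambda>x::'a::real_inner. (1 + x \<bullet> x) powr s) has_derivative
     (\<lambda>v. (2 * s) * (1 + x \<bullet> x) powr (s - 1) * (v \<bullet> x))) (at x)"
proof -
  have pos: "1 + x \<bullet> x > 0"
    by (simp add: add_pos_nonneg)
  then have "((\<lambda>t. t powr s) has_real_derivative s * (1 + x \<bullet> x) powr (s - 1)) (at (1 + x \<bullet> x))"
    by (rule has_real_derivative_powr)
  then have outer: "((\<lambda>t. t powr s) has_derivative (\<lambda>h. s * (1 + x \<bullet> x) powr (s - 1) * h)) (at (1 + x \<bullet> x))"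
    by (simp add: has_field_derivative_def)
  have inner: "((\<lambda>x. 1 + x \<bullet> x) has_derivative (\<lambda>v. 2 * (x \<bullet> v))) (at x)"
    by (auto intro!: derivative_eq_intros simp: inner_commute)
  show ?thesis
    using has_derivative_compose[OF inner outer] by (simp add: algebra_simps inner_commute)
qed

lemma Ck_bracket_powr: "Ck k (\<lambda>x::'a::euclidean_space. (1 + x \<bullet> x) powr s)"
proof (induction k arbitrary: s)
  case 0
  show ?case
    by (auto intro!: continuous_intros simp: add_pos_nonneg less_imp_neq[symmetric]
        add_nonneg_eq_0_iff)
next
  case (Suc k)
  show ?case
    by (rule Ck_SucI[OF has_derivative_bracket_powr])
       (intro Ck_mult Ck_const Suc.IH Ck_inner)
qed

lemma partial_deriv_eqI:
  "(f has_derivative D) (at x) \<Longrightarrow> partial_deriv i f x = D (axis i 1)"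
  unfolding partial_deriv_def by (metis frechet_derivative_at)

lemma partial_deriv_bracket_powr:
  "partial_deriv i (\<lambda>x::real^'d::finite. A * (1 + x \<bullet> x) powr s) =
     (\<lambda>x. (2 * A * s) * ((1 + x \<bullet> x) powr (s - 1) * x $ i))"
proof
  fix x :: "real^'d"
  show "partial_deriv i (\<lambda>x. A * (1 + x \<bullet> x) powr s) x = (2 * A * s) * ((1 + x \<bullet> x) powr (s - 1) * x $ i)"
    using partial_deriv_eqI[OF has_derivative_mult_right[OF has_derivative_bracket_powr], of i A s x]
    by (simp add: inner_axis')
qed

lemma gradient_bracket_powr:
  "gradient (\<lambda>x::real^'d::finite. A * (1 + x \<bullet> x) powr s) x =
     (2 * A * s * (1 + x \<bullet> x) powr (s - 1)) *\<^sub>R x"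
  by (simp add: vec_eq_iff gradient_def partial_deriv_bracket_powr)

lemma laplacian_bracket_powr:
  "laplacian (\<lambda>x::real^'d::finite. A * (1 + x \<bullet> x) powr s) x =
     2 * A * s * (CARD('d) * (1 + x \<bullet> x) powr (s - 1)
                  + 2 * (s - 1) * (1 + x \<bullet> x) powr (s - 2) * (x \<bullet> x))"
proof -
  have "partial_deriv i (\<lambda>x. (2 * A * s) * ((1 + x \<bullet> x) powr (s - 1) * x $ i)) x =
      2 * A * s * ((1 + x \<bullet> x) powr (s - 1)
         + 2 * (s - 1) * (1 + x \<bullet> x) powr (s - 2) * (x $ i * x $ i))" for i
  proof -
    have "((\<lambda>x::real^'d. x $ i) has_derivative (\<lambda>v. v $ i)) (at x)"
      by (rule bounded_linear_imp_has_derivative[OF bounded_linear_vec_nth])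
    from partial_deriv_eqI[OF has_derivative_mult_right
        [OF has_derivative_mult[OF has_derivative_bracket_powr this]], of i "2 * A * s" "s - 1"]
    show ?thesis
      by (simp add: inner_axis' algebra_simps)
  qed
  moreover have "x \<bullet> x = (\<Sum>i\<in>UNIV. x $ i * x $ i)"
    by (simp add: inner_vec_def)
  ultimately show ?thesis
    by (simp add: laplacian_def partial_deriv_bracket_powr sum.distrib flip: sum_distrib_left)
qed

section \<open>The effective potential and the radial profile\<close>

text \<open>
  With \<open>u = ln s\<close> the left-hand side is a convex combination, up to scaling, of \<open>exp (p u)\<close> and
  \<open>exp (-\<eta> u)\<close>, and the weights \<open>\<eta>\<close>, \<open>p\<close> cancel the linear terms in \<open>exp y \<ge> 1 + y\<close>.
\<close>

lemma two_power_profile_ge: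
  fixes p \<eta> s :: real
  assumes "p > 0" "\<eta> > 0" "s > 0"
  shows "\<eta> * s powr p + p * s powr (- \<eta>) \<ge> \<eta> + p"
proof -
  have "\<eta> * (1 + p * ln s) + p * (1 + - \<eta> * ln s) \<le> \<eta> * exp (p * ln s) + p * exp (- \<eta> * ln s)"
    using assms by (intro add_mono mult_left_mono exp_ge_add_one_self) auto
  then show ?thesis
    using assms by (simp add: powr_def algebra_simps)
qed

text \<open>
  The potential strength is written as \<open>(K p / \<eta>) r powr (p + \<eta>)\<close>, which makes \<open>t = r\<close> the
  minimiser of the right-hand side: its derivative in \<open>t\<close> vanishes there. The left-hand side is
  the minimum, obtained by rescaling \<open>t\<close> by \<open>r\<close>.
\<close>

lemma two_power_sum_ge:
  fixes p \<eta> K r t :: real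
  assumes "p > 0" "\<eta> > 0" "K > 0" "r > 0" "t > 0"
  shows "(K + K * p / \<eta>) * r powr p \<le> K * t powr p + (K * p / \<eta> * r powr (p + \<eta>)) * t powr (- \<eta>)"
proof -
  have "(\<eta> + p) * (K / \<eta> * r powr p)
      \<le> (\<eta> * (t / r) powr p + p * (t / r) powr (- \<eta>)) * (K / \<eta> * r powr p)"
    using assms by (intro mult_right_mono two_power_profile_ge) auto
  also have "\<dots> = K * ((t / r) powr p * r powr p) + K * p / \<eta> * ((t / r) powr (- \<eta>) * r powr p)"
    using assms by (simp add: field_simps)
  also have "(t / r) powr p * r powr p = t powr p"
    using assms by (simp add: powr_divide)
  also have "(t / r) powr (- \<eta>) * r powr p = r powr (p + \<eta>) * t powr (- \<eta>)"
    using assms by (simp add: powr_divide powr_add powr_minus field_simps)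
  finally show ?thesis
    using assms by (simp add: field_simps)
qed

lemma one_plus_square_powr_limit:
  "((\<lambda>r::real. (1 + r powr (-2)) powr s) \<longlongrightarrow> 1) at_top"
proof -
  have "((\<lambda>r::real. (1 + r powr (-2)) powr s) \<longlongrightarrow> (1 + 0) powr s) at_top"
    by (intro tendsto_intros tendsto_neg_powr filterlim_ident) auto
  then show ?thesis by simp
qed

lemma one_plus_square_powr_eq:
  fixes r s :: real
  assumes "r > 0"
  shows "(1 + r\<^sup>2) powr s = (1 + r powr (-2)) powr s * r powr (2 * s)"
proof -
  have "1 + r\<^sup>2 = (1 + r powr (-2)) * r powr 2"
    using assms by (simp add: powr_minus field_simps)
  then have "(1 + r\<^sup>2) powr s = ((1 + r powr (-2)) * r powr 2) powr s"
    by (rule arg_cong)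
  then show ?thesis
    by (simp only: powr_mult powr_powr mult.commute)
qed

text \<open>
  The numerator is \<open>- \<Delta>\<phi> + b \<bullet> D\<phi> + |D\<phi>|\<^sup>m / m\<close> at distance \<open>r\<close> from the origin, for a
  function with \<open>D\<phi> = - c (1 + |x|\<^sup>2)\<^sup>q x\<close> in dimension \<open>N\<close>. The exponent \<open>q\<close> and the constant \<open>c\<close> are
  chosen so that \<open>|D\<phi>|\<close> is asymptotic to \<open>|b| powr (ms - 1)\<close> and \<open>D\<phi>\<close> points against \<open>b\<close>, which is the
  equality case of Young's inequality. The drift contributes \<open>-\<rho>\<^sup>m\<^sup>s\<close>, the gradient term
  \<open>\<rho>\<^sup>m\<^sup>s / m\<close>, and the Laplacian is smaller by the factor \<open>r powr (- (\<delta> + 1))\<close>.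
\<close>

lemma radial_operator_limit:
  fixes m ms \<delta> \<rho> a N :: real
  assumes "m > 1" "ms = m / (m - 1)" "\<delta> > 0" "\<rho> > 0"
  defines "c \<equiv> \<rho> powr (ms - 1)" and "q \<equiv> (\<delta> * (ms - 1) + 1) / 2 - 1"
  shows "((\<lambda>r. (c * (N * (1 + r\<^sup>2) powr q + 2 * q * (1 + r\<^sup>2) powr (q - 1) * r\<^sup>2)
            - (\<rho> + a * inverse r) * r powr (\<delta> - 1) * (c * (1 + r\<^sup>2) powr q * r\<^sup>2)
            + 1 / m * (c * (1 + r\<^sup>2) powr q * r) powr m) / r powr (\<delta> * ms))
          \<longlongrightarrow> - (\<rho> powr ms / ms)) at_top"
proof -
  define u where "u = (\<lambda>r::real. 1 + r powr (-2))"
  have ms: "(ms - 1) * m = ms" "1 / m + 1 / ms = 1"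
    using assms(1,2) by (simp add: field_simps, simp add: diff_divide_distrib)
  have q2: "2 * q = \<delta> * ms - \<delta> - 1"
    by (simp add: q_def field_simps)
  \<comment> \<open>Dividing by \<open>r powr (\<delta> * ms)\<close> leaves powers of \<open>u\<close>, which tend to 1, times explicit powers of \<open>r\<close>.\<close>
  have expanded: "eventually (\<lambda>r. c * N * u r powr q * r powr (- (\<delta> + 1))
            + c * 2 * q * u r powr (q - 1) * r powr (- (\<delta> + 1))
            - (\<rho> + a * inverse r) * c * u r powr q + 1 / m * (c powr m * u r powr (q * m))
         = (c * (N * (1 + r\<^sup>2) powr q + 2 * q * (1 + r\<^sup>2) powr (q - 1) * r\<^sup>2)
            - (\<rho> + a * inverse r) * r powr (\<delta> - 1) * (c * (1 + r\<^sup>2) powr q * r\<^sup>2)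
            + 1 / m * (c * (1 + r\<^sup>2) powr q * r) powr m) / r powr (\<delta> * ms)) at_top"
    using eventually_gt_at_top[of 0]
  proof eventually_elim
    case (elim r)
    have r2: "r\<^sup>2 = r powr 2" using elim by simp
    have "(1 + r\<^sup>2) powr q / r powr (\<delta> * ms) = u r powr q * r powr (- (\<delta> + 1))"
    proof -
      have "r powr (2 * q) / r powr (\<delta> * ms) = r powr (- (\<delta> + 1))"
        unfolding powr_diff[symmetric] q2 by (simp add: algebra_simps)
      then show ?thesis
        unfolding one_plus_square_powr_eq[OF elim] u_def by (simp only: times_divide_eq_right[symmetric])
    qed
    moreover have "(1 + r\<^sup>2) powr (q - 1) * r\<^sup>2 / r powr (\<delta> * ms) = u r powr (q - 1) * r powr (- (\<delta> + 1))"
    proof -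
      have "r powr (2 * (q - 1)) * r powr 2 / r powr (\<delta> * ms) = r powr (- (\<delta> + 1))"
        unfolding powr_add[symmetric] powr_diff[symmetric] right_diff_distrib q2 by (simp add: algebra_simps)
      then show ?thesis
        unfolding one_plus_square_powr_eq[OF elim] u_def unfolding r2 by (simp only: times_divide_eq_right[symmetric] mult.assoc)
    qed
    moreover have "r powr (\<delta> - 1) * ((1 + r\<^sup>2) powr q * r\<^sup>2) / r powr (\<delta> * ms) = u r powr q"
    proof -
      have "r powr (\<delta> - 1) * (r powr (2 * q) * r powr 2) / r powr (\<delta> * ms) = r powr 0"
        unfolding powr_add[symmetric] powr_diff[symmetric] q2 by (simp add: algebra_simps)
      then have "u r powr q * (r powr (\<delta> - 1) * (r powr (2 * q) * r powr 2) / r powr (\<delta> * ms)) = u r powr q"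
        using elim by simp
      then show ?thesis
        unfolding one_plus_square_powr_eq[OF elim] u_def unfolding r2
        by (simp only: times_divide_eq_right mult.left_commute mult.assoc)
    qed
    moreover have "(c * (1 + r\<^sup>2) powr q * r) powr m / r powr (\<delta> * ms) = c powr m * u r powr (q * m)"
    proof -
      have "r powr (2 * q) * r = r powr (\<delta> * (ms - 1))"
        using elim powr_add[of r "2 * q" 1] unfolding q2 by (simp add: algebra_simps)
      then have "(c * (1 + r\<^sup>2) powr q * r) powr m = (c * (u r powr q * r powr (\<delta> * (ms - 1)))) powr m"
        unfolding one_plus_square_powr_eq[OF elim] u_def by (simp only: mult.assoc)
      also have "\<dots> = c powr m * (u r powr (q * m) * r powr (\<delta> * ((ms - 1) * m)))"
        by (simp add: c_def powr_mult powr_powr mult.assoc)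
      finally show ?thesis
        using elim by (simp add: ms(1))
    qed
    moreover have "(c * (N * P + 2 * q * S * z) - k * T * (c * P * z) + 1 / m * W) / Y =
        c * N * (P / Y) + c * 2 * q * (S * z / Y) - k * c * (T * (P * z) / Y) + 1 / m * (W / Y)"
      for P S T W Y z k :: real
      by (simp add: divide_inverse algebra_simps)
    ultimately show ?case
      by (simp only: mult.assoc)
  qed
  have limit: "((\<lambda>r. c * N * u r powr q * r powr (- (\<delta> + 1))
            + c * 2 * q * u r powr (q - 1) * r powr (- (\<delta> + 1))
            - (\<rho> + a * inverse r) * c * u r powr q + 1 / m * (c powr m * u r powr (q * m)))
      \<longlongrightarrow> c * N * 1 * 0 + c * 2 * q * 1 * 0 - (\<rho> + a * 0) * c * 1 + 1 / m * (c powr m * 1)) at_top"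
    unfolding u_def using assms(3)
    by (intro tendsto_intros one_plus_square_powr_limit tendsto_neg_powr filterlim_ident
        tendsto_inverse_0_at_top) auto
  have "c * N * 1 * 0 + c * 2 * q * 1 * 0 - (\<rho> + a * 0) * c * 1 + 1 / m * (c powr m * 1)
      = - (\<rho> powr ms / ms)"
  proof -
    have "\<rho> * c = \<rho> powr ms"
      using \<open>\<rho> > 0\<close> powr_add[of \<rho> 1 "ms - 1"] by (simp add: c_def)
    moreover have "c powr m = \<rho> powr ms"
      by (simp add: c_def powr_powr ms(1))
    moreover have "\<rho> powr ms / m + \<rho> powr ms / ms = \<rho> powr ms"
      using arg_cong[OF ms(2), of "\<lambda>x. \<rho> powr ms * x"] by (simp add: distrib_left)
    ultimately show ?thesis
      by (simp add: algebra_simps)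
  qed
  then show ?thesis
    using Lim_transform_eventually[OF limit expanded] by (simp only:)
qed

section \<open>Touching by a barrier\<close>

text \<open>
  A positive second derivative would make \<open>f'\<close>, which vanishes at \<open>t\<close>, positive just to the right of
  \<open>t\<close>, and the mean value theorem would give larger values of \<open>f\<close> there.
\<close>

lemma second_derivative_local_max_nonpos:
  fixes f f' :: "real \<Rightarrow> real"
  assumes "e > 0"
    and f': "\<And>s. \<bar>s - t\<bar> < e \<Longrightarrow> (f has_real_derivative f' s) (at s)"
    and f'': "(f' has_real_derivative f'') (at t)"
    and max: "\<And>s. \<bar>s - t\<bar> < e \<Longrightarrow> f s \<le> f t"
  shows "f' t = 0" and "f'' \<le> 0"
proof -
  show crit: "f' t = 0"
    using DERIV_local_max[OF f'[of t] \<open>e > 0\<close>] \<open>e > 0\<close> max by (simp add: abs_minus_commute)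
  show "f'' \<le> 0"
  proof (rule ccontr)
    assume "\<not> f'' \<le> 0"
    then obtain r where "r > 0" and r: "\<And>h. 0 < h \<Longrightarrow> h < r \<Longrightarrow> f' t < f' (t + h)"
      using DERIV_pos_inc_right[OF f''] by auto
    define h where "h = min r e / 2"
    have h: "0 < h" "h < r" "h < e"
      using \<open>r > 0\<close> \<open>e > 0\<close> by (auto simp: h_def)
    obtain z where z: "t < z" "z < t + h" "f (t + h) - f t = h * f' z"
      using MVT2[of t "t + h" f f'] f' h by auto
    have "f' z > 0"
      using r[of "z - t"] z h crit by simp
    then have "f (t + h) > f t"
      using z(3) \<open>0 < h\<close> by (metis diff_gt_0_iff_gt mult_pos_pos)
    then show False
      using max[of "t + h"] h by simp
  qed
qed

text \<open>
  The barrier is \<open>h t = (1 - t\<^sup>2)\<^sup>-\<^sup>k\<close>. Writing \<open>s = 1 / (1 - t\<^sup>2)\<close>, the second derivative is of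
  order \<open>s ^ (k + 2)\<close> and \<open>|h'| powr m\<close> of order \<open>s powr ((k + 1) m)\<close> near the ends of the interval. For \<open>k\<close> large
  the second exponent is the bigger one because \<open>m > 1\<close>, so however small \<open>\<epsilon>\<close> is, the gradient
  term absorbs \<open>h''\<close> up to a constant.
\<close>

lemma exists_blow_up_barrier:
  fixes m \<epsilon> :: real
  assumes "m > 1" "\<epsilon> > 0"
  obtains h h' h'' :: "real \<Rightarrow> real" and C :: real where
    "\<And>t. \<bar>t\<bar> < 1 \<Longrightarrow> h t \<ge> 0"
    "\<And>t. \<bar>t\<bar> < 1 \<Longrightarrow> (h has_real_derivative h' t) (at t)"
    "\<And>t. \<bar>t\<bar> < 1 \<Longrightarrow> (h' has_real_derivative h'' t) (at t)"
    "\<And>t. \<bar>t\<bar> < 1 \<Longrightarrow> h'' t \<le> \<epsilon> * \<bar>h' t\<bar> powr m + C"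
    "\<And>N. \<exists>\<tau>. 0 < \<tau> \<and> \<tau> < 1 \<and> (\<forall>t. \<tau> < \<bar>t\<bar> \<and> \<bar>t\<bar> < 1 \<longrightarrow> h t > N)"
proof -
  obtain k :: nat where k: "real k > 1 / (m - 1)"
    using reals_Archimedean2 by blast
  then have "k > 0"
    using assms by (smt (verit) divide_pos_pos of_nat_0_less_iff)
  \<comment> \<open>The surplus of the exponent of \<open>|h'| powr m\<close> over that of \<open>h''\<close>, as powers of \<open>s\<close>.\<close>
  define e where "e = (real k + 1) * m - (real k + 2)"
  have "real k * (m - 1) > 1"
    using k assms by (simp add: field_simps)
  then have e: "e > 0"
    using assms by (simp add: e_def algebra_simps)
  define s where "s = (\<lambda>t::real. inverse (1 - t\<^sup>2))"
  define h where "h = (\<lambda>t. s t ^ k)"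
  define h' where "h' = (\<lambda>t::real. 2 * real k * t * s t ^ (k + 1))"
  define h'' where "h'' = (\<lambda>t::real. 2 * real k * s t ^ (k + 1) + 4 * real k * (real k + 1) * t\<^sup>2 * s t ^ (k + 2))"
  define c where "c = 2 * real k + 4 * real k * (real k + 1)"
  have "c > 0"
    using \<open>k > 0\<close> by (simp add: c_def add_pos_nonneg)
  \<comment> \<open>Where \<open>s\<close> exceeds this maximum, \<open>|t| > 1/2\<close> and the gradient term wins; elsewhere \<open>h'' \<le> C\<close>.\<close>
  define C where "C = c * (max 2 ((c / \<epsilon>) powr (1 / e))) ^ (k + 2)"
  have s_ge1: "s t \<ge> 1" and sq_lt1: "t\<^sup>2 < 1" if "\<bar>t\<bar> < 1" for t
  proof -
    show "t\<^sup>2 < 1"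
      using that by (simp add: abs_square_less_1)
    then show "s t \<ge> 1"
      by (simp add: s_def one_le_inverse)
  qed
  have s': "(s has_real_derivative 2 * t * (s t)\<^sup>2) (at t)" if "\<bar>t\<bar> < 1" for t
    unfolding s_def using sq_lt1[OF that]
    by (auto intro!: derivative_eq_intros simp: power2_eq_square)
  have h_deriv: "(h has_real_derivative h' t) (at t)" if "\<bar>t\<bar> < 1" for t
  proof -
    have "s t ^ (k - 1) * (s t)\<^sup>2 = s t ^ (k + 1)"
      using \<open>k > 0\<close> by (cases k) (simp_all add: power2_eq_square)
    then show ?thesis
      unfolding h_def h'_def using DERIV_power[OF s'[OF that], of k]
      by (simp add: mult_ac)
  qed
  have h'_deriv: "(h' has_real_derivative h'' t) (at t)" if "\<bar>t\<bar> < 1" for t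
  proof -
    have "((\<lambda>t. t * s t ^ (k + 1)) has_real_derivative
            s t ^ (k + 1) + t * ((k + 1) * (s t ^ k * (2 * t * (s t)\<^sup>2)))) (at t)"
      using DERIV_mult[OF DERIV_ident DERIV_power[OF s'[OF that], of "k + 1"]]
      by (simp add: mult_ac add_ac)
    from DERIV_cmult[OF this, of "2 * real k"] show ?thesis
      unfolding h'_def h''_def by (simp add: power2_eq_square algebra_simps)
  qed
  have h''_le: "h'' t \<le> \<epsilon> * \<bar>h' t\<bar> powr m + C" if "\<bar>t\<bar> < 1" for t
  proof -
    note s1 = s_ge1[OF that] and sq = sq_lt1[OF that]
    have "s t ^ (k + 1) \<le> s t ^ (k + 2)"
      using s1 by (intro power_increasing) auto
    moreover have "t\<^sup>2 * s t ^ (k + 2) \<le> 1 * s t ^ (k + 2)"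
      using s1 sq by (intro mult_right_mono) auto
    ultimately have "2 * real k * s t ^ (k + 1) + (4 * real k * (real k + 1)) * (t\<^sup>2 * s t ^ (k + 2))
        \<le> 2 * real k * s t ^ (k + 2) + (4 * real k * (real k + 1)) * (1 * s t ^ (k + 2))"
      by (intro add_mono mult_left_mono) auto
    then have le_c: "h'' t \<le> c * s t ^ (k + 2)"
      by (simp add: h''_def c_def algebra_simps)
    show ?thesis
    proof (cases "s t \<le> max 2 ((c / \<epsilon>) powr (1 / e))")
      case True
      then have "c * s t ^ (k + 2) \<le> C"
        unfolding C_def using s1 \<open>c > 0\<close> by (intro mult_left_mono power_mono) auto
      moreover have "\<epsilon> * \<bar>h' t\<bar> powr m \<ge> 0"
        using \<open>\<epsilon> > 0\<close> by simp
      ultimately show ?thesis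
        using le_c by linarith
    next
      case False
      then have s2: "s t > 2" and big: "s t > (c / \<epsilon>) powr (1 / e)"
        by auto
      have "c / \<epsilon> = ((c / \<epsilon>) powr (1 / e)) powr e"
        using e \<open>c > 0\<close> \<open>\<epsilon> > 0\<close> by (simp add: powr_powr)
      also have "\<dots> \<le> s t powr e"
        using big e by (intro powr_mono2) auto
      finally have "c \<le> \<epsilon> * s t powr e"
        using \<open>\<epsilon> > 0\<close> by (simp add: field_simps)
      then have "c * s t ^ (k + 2) \<le> \<epsilon> * s t powr e * s t ^ (k + 2)"
        using s1 by (intro mult_right_mono) auto
      also have "\<dots> = \<epsilon> * (s t ^ (k + 1)) powr m"
      proof -
        have "s t ^ (k + 2) = s t powr (real k + 2)" "s t ^ (k + 1) = s t powr (real k + 1)"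
          using s1 powr_realpow[of "s t" "k + 2"] powr_realpow[of "s t" "k + 1"]
          by (simp_all add: add_ac)
        then show ?thesis
          by (simp add: powr_powr e_def flip: powr_add)
      qed
      also have "\<dots> \<le> \<epsilon> * \<bar>h' t\<bar> powr m"
      proof -
        have "1 - t\<^sup>2 < 1 / 2"
          using s2 sq by (simp add: s_def field_simps)
        then have "(1/2)\<^sup>2 < \<bar>t\<bar>\<^sup>2"
          by (simp add: power2_eq_square)
        then have "1 / 2 < \<bar>t\<bar>"
          using power_less_imp_less_base abs_ge_zero by blast
        then have "1 \<le> 2 * real k * \<bar>t\<bar>"
          using \<open>k > 0\<close> mult_mono[of 1 "real k" 1 "2 * \<bar>t\<bar>"] by simp
        then have "1 * s t ^ (k + 1) \<le> 2 * real k * \<bar>t\<bar> * s t ^ (k + 1)"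
          using s1 by (intro mult_right_mono) auto
        then have "s t ^ (k + 1) \<le> \<bar>h' t\<bar>"
          using s1 by (simp add: h'_def abs_mult)
        then show ?thesis
          using s1 assms by (intro mult_left_mono powr_mono2) auto
      qed
      moreover have "C \<ge> 0"
        using \<open>c > 0\<close> by (simp add: C_def)
      ultimately show ?thesis
        using le_c by linarith
    qed
  qed
  have "\<exists>\<tau>. 0 < \<tau> \<and> \<tau> < 1 \<and> (\<forall>t. \<tau> < \<bar>t\<bar> \<and> \<bar>t\<bar> < 1 \<longrightarrow> h t > N)" for N
  proof -
    obtain n :: nat where n: "real n > max N 1"
      using reals_Archimedean2 by blast
    define \<tau> where "\<tau> = sqrt (1 - 1 / n)"
    have "0 < \<tau>" "\<tau> < 1"
      using n by (simp_all add: \<tau>_def)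
    moreover have "h t > N" if "\<tau> < \<bar>t\<bar>" "\<bar>t\<bar> < 1" for t
    proof -
      have "1 - 1 / n < t\<^sup>2"
        using that(1) unfolding \<tau>_def by (metis not_less real_sqrt_abs real_sqrt_le_iff)
      then have "s t > n"
        using n sq_lt1[OF that(2)] by (simp add: s_def field_simps)
      moreover have "s t \<le> h t"
        unfolding h_def using s_ge1[OF that(2)] \<open>k > 0\<close> by (simp add: self_le_power)
      ultimately show ?thesis
        using n by linarith
    qed
    ultimately show ?thesis by blast
  qed
  moreover have "h t \<ge> 0" if "\<bar>t\<bar> < 1" for t
    using s_ge1[OF that] by (simp add: h_def)
  ultimately show thesis
    using that[of h h' h'' C] h_deriv h'_deriv h''_le by blast
qed

lemma partial_deriv_along_axis:
  fixes f :: "real^'d::finite \<Rightarrow> real"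
  assumes "f differentiable (at (x + s *\<^sub>R axis i 1))"
  shows "((\<lambda>s. f (x + s *\<^sub>R axis i 1)) has_real_derivative
           partial_deriv i f (x + s *\<^sub>R axis i 1)) (at s)"
proof -
  let ?e = "axis i 1 :: real^'d"
  have f': "(f has_derivative frechet_derivative f (at (x + s *\<^sub>R ?e))) (at (x + s *\<^sub>R ?e))"
    using assms by (simp add: frechet_derivative_works)
  have line: "((\<lambda>s. x + s *\<^sub>R ?e) has_derivative (\<lambda>h. h *\<^sub>R ?e)) (at s)"
    by (auto intro!: derivative_eq_intros)
  have "((\<lambda>s. f (x + s *\<^sub>R ?e)) has_derivative
          (\<lambda>h. frechet_derivative f (at (x + s *\<^sub>R ?e)) (h *\<^sub>R ?e))) (at s)"
    by (rule has_derivative_compose[OF line f'])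
  moreover have "frechet_derivative f (at (x + s *\<^sub>R ?e)) (h *\<^sub>R ?e) =
      partial_deriv i f (x + s *\<^sub>R ?e) * h" for h
    by (simp add: partial_deriv_def linear_cmul[OF has_derivative_linear[OF f']])
  ultimately show ?thesis
    unfolding has_field_derivative_def by (simp only:)
qed

text \<open>
  Young's inequality for \<open>M powr (1/ms) * u\<close> and \<open>M powr (- 1/ms) * v\<close>. Taking \<open>M\<close> slightly above 1 costs little
  in the power of \<open>u\<close> and frees a positive fraction \<open>1 - M powr (- (m - 1))\<close> of \<open>v powr m / m\<close>.
\<close>

lemma Youngs_inequality_weighted:
  fixes m ms M u v :: real
  assumes "m > 1" "ms = m / (m - 1)" "M > 0" "u \<ge> 0" "v \<ge> 0"
  shows "u * v \<le> M powr (- (m - 1)) * (v powr m / m) + M * (u powr ms / ms)"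
proof -
  have ms: "ms > 1" "m / ms = m - 1" "1 / m + 1 / ms = 1"
    using assms(1) by (simp_all add: assms(2) field_simps)
  have "(M powr (- (1 / ms)) * v) * (M powr (1 / ms) * u)
      \<le> (M powr (- (1 / ms)) * v) powr m / m + (M powr (1 / ms) * u) powr ms / ms"
    using assms ms by (intro Youngs_inequality) auto
  also have "(M powr (- (1 / ms)) * v) powr m = M powr (- (m - 1)) * v powr m"
    using assms ms by (simp add: powr_mult powr_powr)
  also have "(M powr (1 / ms) * u) powr ms = M * u powr ms"
    using assms ms by (simp add: powr_mult powr_powr)
  also have "(M powr (- (1 / ms)) * v) * (M powr (1 / ms) * u) = u * v"
    using assms by (simp add: powr_minus field_simps)
  finally show ?thesis by simp
qed

text \<open>
  The barrier tends to infinity at the boundary of the open cube of half-width 1 centred at \<open>x0\<close>, so \<open>\<phi>\<close> minus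
  the barrier attains its maximum inside, whatever the values of \<open>\<phi>\<close> are. This makes the bounds
  derived from it independent of the subsolution.
\<close>

lemma exists_touching_point:
  fixes \<phi> :: "real^'d::finite \<Rightarrow> real" and h :: "real \<Rightarrow> real"
  assumes \<phi>: "continuous_on UNIV \<phi>"
    and h: "continuous_on {-1<..<1} h"
    and nonneg: "\<And>t. \<bar>t\<bar> < 1 \<Longrightarrow> h t \<ge> 0"
    and blow_up: "\<And>N. \<exists>\<tau>. 0 < \<tau> \<and> \<tau> < 1 \<and> (\<forall>t. \<tau> < \<bar>t\<bar> \<and> \<bar>t\<bar> < 1 \<longrightarrow> h t > N)"
  obtains x where "\<And>i. \<bar>x $ i - x0 $ i\<bar> < 1"
    and "\<forall>y. (\<forall>i. \<bar>y $ i - x0 $ i\<bar> < 1) \<longrightarrow>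
           \<phi> y - (\<Sum>i\<in>UNIV. h (y $ i - x0 $ i)) \<le> \<phi> x - (\<Sum>i\<in>UNIV. h (x $ i - x0 $ i))"
proof -
  define g where "g = (\<lambda>y::real^'d. \<Sum>i\<in>UNIV. h (y $ i - x0 $ i))"
  define Q where "Q = (\<lambda>\<tau>. cbox (\<chi> i. x0 $ i - \<tau>) (\<chi> i. x0 $ i + \<tau>))"
  have Q: "y \<in> Q \<tau> \<longleftrightarrow> (\<forall>i. \<bar>y $ i - x0 $ i\<bar> \<le> \<tau>)" for y \<tau>
    unfolding Q_def mem_box_cart by (auto simp: abs_le_iff algebra_simps)
  have "compact (Q 1)" "x0 \<in> Q 1"
    by (auto simp: Q_def mem_box_cart)
  then obtain z where z: "\<And>y. y \<in> Q 1 \<Longrightarrow> \<phi> y \<le> \<phi> z"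
    using continuous_attains_sup[of "Q 1" \<phi>] continuous_on_subset[OF \<phi>] by auto
  \<comment> \<open>Outside the cube of half-width \<open>\<tau>\<close> the barrier already exceeds the threshold that makes \<open>\<phi> - g\<close> smaller than its value at the centre.\<close>
  obtain \<tau> where \<tau>: "0 < \<tau>" "\<tau> < 1"
    and big: "\<And>t. \<tau> < \<bar>t\<bar> \<Longrightarrow> \<bar>t\<bar> < 1 \<Longrightarrow> h t > \<phi> z - (\<phi> x0 - g x0)"
    using blow_up[of "\<phi> z - (\<phi> x0 - g x0)"] by auto
  have "continuous_on (Q \<tau>) (\<lambda>y. h (y $ i - x0 $ i))" for i
    by (rule continuous_on_compose2[OF h]) (use \<tau> in \<open>auto intro!: continuous_intros simp: Q\<close>,
        (smt (verit))+)
  then have "continuous_on (Q \<tau>) (\<lambda>y. \<phi> y - g y)"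
    unfolding g_def by (intro continuous_intros continuous_on_subset[OF \<phi>]) auto
  moreover have "compact (Q \<tau>)" "x0 \<in> Q \<tau>"
    using \<tau> by (auto simp: Q_def mem_box_cart)
  ultimately obtain x where x: "x \<in> Q \<tau>" "\<And>y. y \<in> Q \<tau> \<Longrightarrow> \<phi> y - g y \<le> \<phi> x - g x"
    using continuous_attains_sup[of "Q \<tau>" "\<lambda>y. \<phi> y - g y"] by blast
  show thesis
  proof (rule that[of x])
    show "\<bar>x $ i - x0 $ i\<bar> < 1" for i
      using x(1) \<tau> by (meson Q le_less_trans)
    have "\<phi> y - (\<Sum>i\<in>UNIV. h (y $ i - x0 $ i)) \<le> \<phi> x - (\<Sum>i\<in>UNIV. h (x $ i - x0 $ i))"
      if y: "\<And>i. \<bar>y $ i - x0 $ i\<bar> < 1" for y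
    proof (cases "y \<in> Q \<tau>")
      case True
      with x(2) show ?thesis by (simp add: g_def)
    next
      case False
      then obtain i where "\<bar>y $ i - x0 $ i\<bar> > \<tau>"
        by (auto simp: Q not_le)
      then have "h (y $ i - x0 $ i) > \<phi> z - (\<phi> x0 - g x0)"
        using big y by blast
      moreover have "h (y $ i - x0 $ i) \<le> g y"
        unfolding g_def using nonneg y by (intro member_le_sum) auto
      moreover have "\<phi> y \<le> \<phi> z"
        using y by (intro z) (auto simp: Q less_imp_le)
      moreover have "\<phi> x0 - g x0 \<le> \<phi> x - g x"
        using x(2) \<open>x0 \<in> Q \<tau>\<close> .
      ultimately show ?thesis
        by (simp add: g_def)
    qed
    then show "\<forall>y. (\<forall>i. \<bar>y $ i - x0 $ i\<bar> < 1) \<longrightarrow>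
        \<phi> y - (\<Sum>i\<in>UNIV. h (y $ i - x0 $ i)) \<le> \<phi> x - (\<Sum>i\<in>UNIV. h (x $ i - x0 $ i))"
      by blast
  qed
qed

text \<open>
  The barrier is a sum of functions of one coordinate each. Along a line parallel to a coordinate
  axis only one summand varies, so the one-dimensional second derivative test applies.
\<close>

lemma derivatives_at_touching_point:
  fixes \<phi> :: "real^'d::finite \<Rightarrow> real" and h h' h'' :: "real \<Rightarrow> real"
  assumes \<phi>: "Ck 3 \<phi>"
    and h': "\<And>t. \<bar>t\<bar> < 1 \<Longrightarrow> (h has_real_derivative h' t) (at t)"
    and h'': "\<And>t. \<bar>t\<bar> < 1 \<Longrightarrow> (h' has_real_derivative h'' t) (at t)"
    and x: "\<And>i. \<bar>x $ i - x0 $ i\<bar> < 1"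
    and max: "\<forall>y. (\<forall>i. \<bar>y $ i - x0 $ i\<bar> < 1) \<longrightarrow>
           \<phi> y - (\<Sum>i\<in>UNIV. h (y $ i - x0 $ i)) \<le> \<phi> x - (\<Sum>i\<in>UNIV. h (x $ i - x0 $ i))"
  shows "partial_deriv i \<phi> x = h' (x $ i - x0 $ i)"
    and "partial_deriv i (partial_deriv i \<phi>) x \<le> h'' (x $ i - x0 $ i)"
proof -
  let ?e = "axis i 1 :: real^'d"
  have \<phi>_diff: "\<phi> differentiable (at y)" and \<phi>'_diff: "partial_deriv i \<phi> differentiable (at y)" for y
    using \<phi> unfolding partial_deriv_def[abs_def] by (auto simp: numeral_3_eq_3)
  define t where "t = x $ i - x0 $ i"
  define f where "f = (\<lambda>s. \<phi> (x + s *\<^sub>R ?e) - h (t + s))"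
  define f' where "f' = (\<lambda>s. partial_deriv i \<phi> (x + s *\<^sub>R ?e) - h' (t + s))"
  have f': "(f has_real_derivative f' s) (at s)" if "\<bar>s - 0\<bar> < 1 - \<bar>t\<bar>" for s
  proof -
    have "\<bar>t + s\<bar> < 1" using that by linarith
    from DERIV_shift[THEN iffD1, OF h'[OF this[unfolded add.commute[of t s]]]] 
    have "((\<lambda>s. h (t + s)) has_real_derivative h' (t + s)) (at s)"
      by (simp add: add.commute)
    then show ?thesis
      unfolding f_def f'_def using partial_deriv_along_axis[OF \<phi>_diff, where x = x and s = s and i = i]
      by (intro DERIV_diff) auto
  qed
  have "((\<lambda>s. h' (t + s)) has_real_derivative h'' (t + 0)) (at 0)"
    using DERIV_shift[THEN iffD1, of h' "h'' t" 0 t] h''[of t] x[of i]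
    by (simp add: add.commute t_def)
  then have f'': "(f' has_real_derivative (partial_deriv i (partial_deriv i \<phi>) x - h'' t)) (at 0)"
    unfolding f'_def using partial_deriv_along_axis[OF \<phi>'_diff, where x = x and s = 0 and i = i]
    by (intro DERIV_diff) auto
  have "f s \<le> f 0" if s: "\<bar>s - 0\<bar> < 1 - \<bar>t\<bar>" for s
  proof -
    let ?y = "x + s *\<^sub>R ?e"
    have y: "?y $ i = x $ i + s" "\<And>j. j \<noteq> i \<Longrightarrow> ?y $ j = x $ j"
      by (auto simp: axis_def)
    have "\<bar>?y $ j - x0 $ j\<bar> < 1" for j
      using x[of j] s by (cases "j = i") (auto simp: y t_def simp del: vector_add_component)
    then have "\<phi> ?y - (\<Sum>j\<in>UNIV. h (?y $ j - x0 $ j)) \<le> \<phi> x - (\<Sum>j\<in>UNIV. h (x $ j - x0 $ j))"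
      using max by blast
    moreover have "(\<Sum>j\<in>UNIV - {i}. h (?y $ j - x0 $ j)) = (\<Sum>j\<in>UNIV - {i}. h (x $ j - x0 $ j))"
      by (intro sum.cong) (auto simp: y simp del: vector_add_component)
    moreover have "h (?y $ i - x0 $ i) = h (t + s)"
      by (simp add: y t_def algebra_simps)
    ultimately show ?thesis
      by (simp add: f_def t_def sum.remove[of UNIV i] del: vector_add_component)
  qed
  moreover have "1 - \<bar>t\<bar> > 0"
    using x[of i] by (simp add: t_def)
  ultimately have "f' 0 = 0" "partial_deriv i (partial_deriv i \<phi>) x - h'' t \<le> 0"
    using second_derivative_local_max_nonpos[of "1 - \<bar>t\<bar>" 0 f f', OF _ f' f''] by blast+
  then show "partial_deriv i \<phi> x = h' (x $ i - x0 $ i)"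
    "partial_deriv i (partial_deriv i \<phi>) x \<le> h'' (x $ i - x0 $ i)"
    by (auto simp: f'_def t_def)
qed

text \<open>
  At the point where \<open>\<phi>\<close> touches the barrier, \<open>D\<phi>\<close> and the diagonal of the Hessian of \<open>\<phi>\<close>
  are controlled by the barrier. Young's inequality with weight \<open>M\<close> bounds \<open>- b \<bullet> D\<phi>\<close> and leaves a
  fraction of \<open>|D\<phi>|\<^sup>m / m\<close>, into which the barrier inequality absorbs \<open>\<Delta>\<phi>\<close>. The resulting constant
  \<open>C\<close> depends only on \<open>m\<close>, \<open>M\<close> and the dimension, and neither on \<open>b\<close>, \<open>V\<close>, \<open>\<beta>\<close> nor on the
  location \<open>x0\<close>; it therefore disappears in the limit when \<open>x0\<close> is moved to infinity.
\<close>

lemma subsolution_local_bound: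
  fixes m ms M :: real
  assumes "m > 1" "ms = m / (m - 1)" "M > 1"
  obtains C where "\<And>(b :: real^'d::finite \<Rightarrow> real^'d) V \<beta> \<mu> \<phi> x0. EP_subsolution m b V \<beta> \<mu> \<phi> \<Longrightarrow>
    \<exists>x. norm (x - x0) \<le> CARD('d) \<and> \<mu> \<le> C + M * (norm (b x) powr ms / ms) + \<beta> * V x"
proof -
  define d where "d = real CARD('d)"
  define w where "w = M powr (- (m - 1))"
  have "d > 0" by (simp add: d_def)
  have "w < 1"
    using powr_less_mono[of "- (m - 1)" 0 M] assms by (simp add: w_def)
  then have "(1 - w) / (m * d) > 0"
    using \<open>d > 0\<close> assms by simp
  \<comment> \<open>The divisor \<open>d\<close> accounts for summing the one-dimensional inequalities over all coordinates.\<close>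
  from exists_blow_up_barrier[OF \<open>m > 1\<close> this] obtain h h' h'' :: "real \<Rightarrow> real" and C where
    h: "\<And>t. \<bar>t\<bar> < 1 \<Longrightarrow> h t \<ge> 0"
    and h': "\<And>t. \<bar>t\<bar> < 1 \<Longrightarrow> (h has_real_derivative h' t) (at t)"
    and h'': "\<And>t. \<bar>t\<bar> < 1 \<Longrightarrow> (h' has_real_derivative h'' t) (at t)"
    and super: "\<And>t. \<bar>t\<bar> < 1 \<Longrightarrow> h'' t \<le> (1 - w) / (m * d) * \<bar>h' t\<bar> powr m + C"
    and blow_up: "\<And>N. \<exists>\<tau>. 0 < \<tau> \<and> \<tau> < 1 \<and> (\<forall>t. \<tau> < \<bar>t\<bar> \<and> \<bar>t\<bar> < 1 \<longrightarrow> h t > N)"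
    by blast
  have h_cont: "continuous_on {-1<..<1} h"
    by (intro continuous_at_imp_continuous_on ballI DERIV_isCont[OF h']) auto
  show thesis
  proof (rule that)
    fix b :: "real^'d \<Rightarrow> real^'d" and V \<beta> \<mu> \<phi> x0
    assume sub: "EP_subsolution m b V \<beta> \<mu> \<phi>"
    then have \<phi>: "Ck 3 \<phi>" by (simp add: EP_subsolution_def)
    obtain x where x: "\<And>i. \<bar>x $ i - x0 $ i\<bar> < 1"
      and max: "\<forall>y. (\<forall>i. \<bar>y $ i - x0 $ i\<bar> < 1) \<longrightarrow>
           \<phi> y - (\<Sum>i\<in>UNIV. h (y $ i - x0 $ i)) \<le> \<phi> x - (\<Sum>i\<in>UNIV. h (x $ i - x0 $ i))"
      using exists_touching_point[OF Ck_imp_continuous[OF \<phi>] h_cont h blow_up] by blast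
    have touch: "partial_deriv i \<phi> x = h' (x $ i - x0 $ i)"
      "partial_deriv i (partial_deriv i \<phi>) x \<le> h'' (x $ i - x0 $ i)" for i
      using derivatives_at_touching_point[OF \<phi> h' h'' x max] by blast+
    let ?P = "gradient \<phi> x"
    have "laplacian \<phi> x \<le> (\<Sum>i\<in>(UNIV :: 'd set). (1 - w) / (m * d) * norm ?P powr m + C)"
      unfolding laplacian_def
    proof (rule sum_mono)
      fix i :: 'd
      have "\<bar>h' (x $ i - x0 $ i)\<bar> powr m \<le> norm ?P powr m"
        using component_le_norm_cart[of ?P i] \<open>m > 1\<close>
        by (intro powr_mono2) (auto simp: gradient_def touch(1))
      then have "(1 - w) / (m * d) * \<bar>h' (x $ i - x0 $ i)\<bar> powr m \<le> (1 - w) / (m * d) * norm ?P powr m"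
        using \<open>(1 - w) / (m * d) > 0\<close> by (intro mult_left_mono) auto
      then show "partial_deriv i (partial_deriv i \<phi>) x \<le> (1 - w) / (m * d) * norm ?P powr m + C"
        using touch(2)[of i] super[OF x[of i]] by linarith
    qed
    also have "\<dots> = (1 - w) * (norm ?P powr m / m) + d * C"
      using \<open>d > 0\<close> \<open>m > 1\<close> by (simp add: d_def[symmetric] field_simps)
    finally have lap: "laplacian \<phi> x \<le> (1 - w) * (norm ?P powr m / m) + d * C" .
    have "- (b x \<bullet> ?P) \<le> norm (b x) * norm ?P"
      using Cauchy_Schwarz_ineq2[of "b x" ?P] by linarith
    also have "\<dots> \<le> w * (norm ?P powr m / m) + M * (norm (b x) powr ms / ms)"
      unfolding w_def using assms by (intro Youngs_inequality_weighted) auto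
    finally have drift: "- (b x \<bullet> ?P) \<le> w * (norm ?P powr m / m) + M * (norm (b x) powr ms / ms)" .
    have "\<mu> - laplacian \<phi> x + b x \<bullet> ?P + norm ?P powr m / m - \<beta> * V x \<le> 0"
      using sub by (simp add: EP_subsolution_def EP_lhs_def)
    then have "\<mu> \<le> d * C + M * (norm (b x) powr ms / ms) + \<beta> * V x"
      using lap drift left_diff_distrib[of 1 w "norm ?P powr m / m"] by linarith
    moreover have "norm (x - x0) \<le> CARD('d)"
    proof -
      have "norm (x - x0) \<le> (\<Sum>i\<in>UNIV. \<bar>(x - x0) $ i\<bar>)"
        by (rule norm_le_l1_cart)
      also have "\<dots> \<le> (\<Sum>i\<in>(UNIV::'d set). 1)"
        using x by (intro sum_mono) (simp add: less_imp_le)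
      finally show ?thesis by simp
    qed
    ultimately show "\<exists>x. norm (x - x0) \<le> CARD('d) \<and>
        \<mu> \<le> d * C + M * (norm (b x) powr ms / ms) + \<beta> * V x"
      by blast
  qed
qed

section \<open>Bounds for the eigenvalue in terms of the optimal radius\<close>

text \<open>
  One function \<open>\<phi>\<close>, independent of \<open>\<beta>\<close>, serves for all large \<open>\<beta>\<close>. Far out, the terms with
  derivatives of \<open>\<phi>\<close> sum to at most \<open>-\<kappa> K |x|\<^sup>p\<close>, and \<open>\<kappa> (K |x|\<^sup>p + \<beta> |x| powr (-\<eta>))\<close> dominates \<open>\<kappa>\<close> times the minimum of the
  effective potential. On the remaining fixed ball that sum is bounded while \<open>V\<close> has a
  positive minimum, so \<open>\<beta> V\<close>, of order \<open>r powr (p + \<eta>)\<close>, beats the level, which is of order \<open>r\<^sup>p\<close>.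
\<close>

lemma exists_near_optimal_subsolution:
  fixes b :: "real^'d::finite \<Rightarrow> real^'d" and V :: "real^'d \<Rightarrow> real"
    and m ms \<delta> \<rho> R a \<eta> \<kappa> :: real
  assumes "m > 1" and ms: "ms = m / (m - 1)"
    and "\<delta> > 0" and "\<rho> > 0" and "R > 0" and "\<eta> > 0"
    and struct: "structural_assumptions \<delta> \<rho> R a \<eta> b V"
    and \<kappa>: "0 < \<kappa>" "\<kappa> < 1"
  defines "p \<equiv> \<delta> * ms" and "K \<equiv> \<rho> powr ms / ms"
  defines "B \<equiv> K * p / \<eta>"
  shows "eventually (\<lambda>r. \<exists>\<phi>. EP_subsolution m b V (B * r powr (p + \<eta>)) (\<kappa> * ((K + B) * r powr p)) \<phi>) at_top"
proof -
  have "ms > 1"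
    using \<open>m > 1\<close> by (simp add: ms field_simps)
  then have "p > 0" "K > 0"
    using \<open>\<delta> > 0\<close> \<open>\<rho> > 0\<close> by (simp_all add: p_def K_def)
  then have "B > 0"
    using \<open>\<eta> > 0\<close> by (simp add: B_def)
  define c where "c = \<rho> powr (ms - 1)"
  define \<gamma> where "\<gamma> = \<delta> * (ms - 1) + 1"
  define q where "q = \<gamma> / 2 - 1"
  define \<phi> where "\<phi> = (\<lambda>x::real^'d. (- c / \<gamma>) * (1 + x \<bullet> x) powr (\<gamma> / 2))"
  have "c > 0" "\<gamma> > 0"
    using \<open>\<rho> > 0\<close> \<open>\<delta> > 0\<close> \<open>ms > 1\<close> by (simp_all add: c_def \<gamma>_def add_pos_pos)
  have smooth: "Ck 3 \<phi>"
    unfolding \<phi>_def by (intro Ck_mult Ck_const Ck_bracket_powr)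
  define T where "T = (\<lambda>x. - laplacian \<phi> x + b x \<bullet> gradient \<phi> x + 1 / m * norm (gradient \<phi> x) powr m)"
  have coeff: "2 * (- c / \<gamma>) * (\<gamma> / 2) = - c"
    using \<open>\<gamma> > 0\<close> by simp
  have grad: "gradient \<phi> x = (- (c * (1 + x \<bullet> x) powr q)) *\<^sub>R x" for x
    unfolding \<phi>_def gradient_bracket_powr coeff by (simp add: q_def)
  have lap: "laplacian \<phi> x = - (c * (CARD('d) * (1 + x \<bullet> x) powr q + 2 * q * (1 + x \<bullet> x) powr (q - 1) * (x \<bullet> x)))" for x
    unfolding \<phi>_def laplacian_bracket_powr coeff by (simp add: q_def)
  have EP: "EP_lhs m b V \<beta> \<mu> \<phi> x = \<mu> + T x - \<beta> * V x" for \<beta> \<mu> x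
    by (simp add: EP_lhs_def T_def)
  have b_cont: "continuous_on UNIV b" and V_cont: "continuous_on UNIV V"
    using struct by (auto simp: structural_assumptions_def intro: Ck_imp_continuous)
  have bracket_cont: "continuous_on UNIV (\<lambda>x::real^'d. (1 + x \<bullet> x) powr s)" for s
    by (rule Ck_imp_continuous[OF Ck_bracket_powr])
  have grad_cont: "continuous_on UNIV (gradient \<phi>)"
    unfolding grad[abs_def] by (intro continuous_on_scaleR continuous_on_minus continuous_on_mult
        continuous_on_const continuous_on_id bracket_cont)
  have lap_cont: "continuous_on UNIV (laplacian \<phi>)"
    unfolding lap[abs_def] by (intro continuous_on_minus continuous_on_mult continuous_on_add
        continuous_on_const continuous_on_inner continuous_on_id bracket_cont)
  have T_cont: "continuous_on UNIV T"
    unfolding T_def using \<open>m > 1\<close>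
    by (intro continuous_on_add continuous_on_minus continuous_on_mult continuous_on_const
        continuous_on_inner continuous_on_powr' continuous_on_norm b_cont grad_cont lap_cont) auto
  have b_out: "b x = ((\<rho> + a * inverse (norm x)) * norm x powr (\<delta> - 1)) *\<^sub>R x"
    and V_out: "V x = norm x powr (- \<eta>)" if "norm x \<ge> R" for x
    using struct that by (auto simp: structural_assumptions_def)
  define G where "G = (\<lambda>s. c * (real CARD('d) * (1 + s\<^sup>2) powr q + 2 * q * (1 + s\<^sup>2) powr (q - 1) * s\<^sup>2)
            - (\<rho> + a * inverse s) * s powr (\<delta> - 1) * (c * (1 + s\<^sup>2) powr q * s\<^sup>2)
            + 1 / m * (c * (1 + s\<^sup>2) powr q * s) powr m)"
  have T_radial: "T x = G (norm x)" if "norm x \<ge> R" for x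
  proof -
    have "norm (gradient \<phi> x) = c * (1 + (norm x)\<^sup>2) powr q * norm x"
      unfolding grad using \<open>c > 0\<close> by (simp add: abs_mult power2_norm_eq_inner)
    moreover have "b x \<bullet> gradient \<phi> x = - ((\<rho> + a * inverse (norm x)) * norm x powr (\<delta> - 1)
        * (c * (1 + (norm x)\<^sup>2) powr q * (norm x)\<^sup>2))"
      unfolding grad b_out[OF that] power2_norm_eq_inner inner_scaleR_left inner_scaleR_right
      by (simp only: mult_minus_left mult_minus_right mult_ac)
    ultimately show ?thesis
      unfolding T_def G_def lap power2_norm_eq_inner by (simp only: minus_minus diff_conv_add_uminus)
  qed
  have "((\<lambda>s. G s / s powr p) \<longlongrightarrow> - (\<rho> powr ms / ms)) at_top"
    unfolding G_def c_def q_def \<gamma>_def p_def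
    by (rule radial_operator_limit[OF \<open>m > 1\<close> ms \<open>\<delta> > 0\<close> \<open>\<rho> > 0\<close>])
  moreover have "- (\<rho> powr ms / ms) < - (\<kappa> * K)"
    using mult_strict_right_mono[OF \<kappa>(2) \<open>K > 0\<close>] unfolding K_def by linarith
  ultimately have "eventually (\<lambda>s. G s / s powr p < - (\<kappa> * K)) at_top"
    by (rule order_tendstoD(2))
  then obtain R1 where R1: "\<And>s. s \<ge> R1 \<Longrightarrow> G s / s powr p < - (\<kappa> * K)"
    unfolding eventually_at_top_linorder by blast
  define R0 where "R0 = max R R1"
  have outer: "T x \<le> - (\<kappa> * K) * norm x powr p" if "norm x \<ge> R0" for x
  proof -
    have "norm x \<ge> R" "norm x \<ge> R1" "norm x powr p > 0"
      using that \<open>R > 0\<close> by (auto simp: R0_def)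
    then show ?thesis
      using R1[of "norm x"] by (simp add: T_radial pos_divide_less_eq)
  qed
  have ball: "compact (cball 0 R0 :: (real^'d) set)" "cball 0 R0 \<noteq> ({} :: (real^'d) set)"
    using \<open>R > 0\<close> by (auto simp: R0_def)
  obtain y where y: "\<And>x. x \<in> cball 0 R0 \<Longrightarrow> T x \<le> T y"
    using continuous_attains_sup[OF ball continuous_on_subset[OF T_cont subset_UNIV]] by blast
  obtain z where z: "\<And>x. x \<in> cball 0 R0 \<Longrightarrow> V z \<le> V x"
    using continuous_attains_inf[OF ball continuous_on_subset[OF V_cont subset_UNIV]] by blast
  have "V z > 0"
  proof (cases "norm z \<le> R")
    case True
    then show ?thesis using struct by (simp add: structural_assumptions_def)
  next
    case False
    then show ?thesis using V_out[of z] \<open>R > 0\<close> by (cases "z = 0") auto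
  qed
  have "((\<lambda>r::real. \<kappa> * (K + B) * r powr (- \<eta>) + T y * r powr (- (p + \<eta>))) \<longlongrightarrow>
      \<kappa> * (K + B) * 0 + T y * 0) at_top"
    using \<open>\<eta> > 0\<close> \<open>p > 0\<close> by (intro tendsto_intros tendsto_neg_powr filterlim_ident) auto
  then have "eventually (\<lambda>r. \<kappa> * (K + B) * r powr (- \<eta>) + T y * r powr (- (p + \<eta>)) < B * V z) at_top"
    using \<open>B > 0\<close> \<open>V z > 0\<close> by (intro order_tendstoD(2)) auto
  then show ?thesis
    using eventually_gt_at_top[of 0]
  proof eventually_elim
    case (elim r)
    define \<mu> where "\<mu> = \<kappa> * ((K + B) * r powr p)"
    define \<beta> where "\<beta> = B * r powr (p + \<eta>)"
    have "\<beta> > 0"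
      using \<open>B > 0\<close> elim(2) by (simp add: \<beta>_def)
    have inner: "\<mu> + T y \<le> \<beta> * V z"
    proof -
      have "(\<kappa> * (K + B) * r powr (- \<eta>) + T y * r powr (- (p + \<eta>))) * r powr (p + \<eta>)
          \<le> (B * V z) * r powr (p + \<eta>)"
        using elim by (intro mult_right_mono) auto
      also have "(\<kappa> * (K + B) * r powr (- \<eta>) + T y * r powr (- (p + \<eta>))) * r powr (p + \<eta>)
          = \<kappa> * (K + B) * (r powr (- \<eta>) * r powr (p + \<eta>)) + T y * (r powr (- (p + \<eta>)) * r powr (p + \<eta>))"
        by (simp only: distrib_right mult.assoc)
      also have "r powr (- \<eta>) * r powr (p + \<eta>) = r powr p"
        using elim(2) by (simp flip: powr_add)
      also have "r powr (- (p + \<eta>)) * r powr (p + \<eta>) = 1"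
        using elim(2) by (simp flip: powr_add)
      finally show ?thesis
        by (simp add: \<mu>_def \<beta>_def mult_ac)
    qed
    have "EP_lhs m b V \<beta> \<mu> \<phi> x \<le> 0" for x
    proof (cases "norm x \<le> R0")
      case True
      then have "T x \<le> T y" "\<beta> * V z \<le> \<beta> * V x"
        using y z \<open>\<beta> > 0\<close> by auto
      then show ?thesis
        using inner by (simp add: EP)
    next
      case False
      then have x: "norm x \<ge> R0" "norm x > 0" "norm x \<ge> R"
        using \<open>R > 0\<close> by (auto simp: R0_def)
      have "\<mu> \<le> \<kappa> * (K * norm x powr p + \<beta> * norm x powr (- \<eta>))"
        unfolding \<mu>_def \<beta>_def B_def
        using two_power_sum_ge[OF \<open>p > 0\<close> \<open>\<eta> > 0\<close> \<open>K > 0\<close> elim(2) x(2)] \<kappa>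
        by (intro mult_left_mono) auto
      also have "\<dots> \<le> \<kappa> * K * norm x powr p + \<beta> * V x"
        using \<kappa> \<open>\<beta> > 0\<close> mult_right_mono[of \<kappa> 1 "\<beta> * norm x powr (- \<eta>)"]
        by (simp add: V_out[OF x(3)] algebra_simps)
      finally show ?thesis
        using outer[OF x(1)] by (simp add: EP)
    qed
    then show ?case
      using smooth unfolding EP_subsolution_def \<mu>_def \<beta>_def by blast
  qed
qed

text \<open>
  The local bound is applied around a point at distance \<open>r\<close> from the origin, where \<open>r\<close> is the
  minimiser of \<open>K t powr p + \<beta> t powr (-\<eta>)\<close>. On a neighbourhood of bounded size \<open>|b|\<close> and \<open>V\<close> are
  asymptotically constant as \<open>r\<close> grows, so the bound is at most \<open>(M K + B + o(1)) r\<^sup>p\<close>, and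
  \<open>M K + B < M (K + B)\<close> absorbs the error.
\<close>

lemma subsolution_level_upper_bound:
  fixes b :: "real^'d::finite \<Rightarrow> real^'d" and V :: "real^'d \<Rightarrow> real"
    and m ms \<delta> \<rho> R a \<eta> M :: real
  assumes "m > 1" and ms: "ms = m / (m - 1)"
    and "\<delta> > 0" and "\<rho> > 0" and "R > 0" and "\<eta> > 0"
    and struct: "structural_assumptions \<delta> \<rho> R a \<eta> b V"
    and "M > 1"
  defines "p \<equiv> \<delta> * ms" and "K \<equiv> \<rho> powr ms / ms"
  defines "B \<equiv> K * p / \<eta>"
  shows "eventually (\<lambda>r. \<forall>\<mu> \<phi>. EP_subsolution m b V (B * r powr (p + \<eta>)) \<mu> \<phi> \<longrightarrow>
           \<mu> \<le> M * ((K + B) * r powr p)) at_top"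
proof -
  have "ms > 1"
    using \<open>m > 1\<close> by (simp add: ms field_simps)
  then have "p > 0" "K > 0"
    using \<open>\<delta> > 0\<close> \<open>\<rho> > 0\<close> by (simp_all add: p_def K_def)
  then have "B > 0"
    using \<open>\<eta> > 0\<close> by (simp add: B_def)
  define d where "d = real CARD('d)"
  have "d > 0" by (simp add: d_def)
  from subsolution_local_bound[OF \<open>m > 1\<close> ms \<open>M > 1\<close>, where 'd = 'd] obtain C where
    C: "\<And>(b :: real^'d \<Rightarrow> real^'d) V \<beta> \<mu> \<phi> x0. EP_subsolution m b V \<beta> \<mu> \<phi> \<Longrightarrow>
    \<exists>x. norm (x - x0) \<le> d \<and> \<mu> \<le> C + M * (norm (b x) powr ms / ms) + \<beta> * V x"
    unfolding d_def by blast
  \<comment> \<open>The local bound divided by \<open>r powr p\<close>, with \<open>|x|\<close> estimated by \<open>r - d\<close> and \<open>r + d\<close>.\<close>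
  define U where "U = (\<lambda>r. C * r powr (- p)
      + M * ((\<rho> + \<bar>a\<bar> * inverse (r - d)) powr ms * (1 + d * inverse r) powr p / ms)
      + B * (1 - d * inverse r) powr (- \<eta>))"
  have shift: "filterlim (\<lambda>r. r - d) at_top at_top"
    using filterlim_tendsto_add_at_top[OF tendsto_const[of "- d"] filterlim_ident] by (simp add: add.commute)
  have "(U \<longlongrightarrow> C * 0 + M * ((\<rho> + \<bar>a\<bar> * 0) powr ms * (1 + d * 0) powr p / ms) + B * (1 - d * 0) powr (- \<eta>)) at_top"
    unfolding U_def using \<open>p > 0\<close> \<open>\<rho> > 0\<close> \<open>ms > 1\<close>
    by (intro tendsto_inverse_0_at_top[OF shift] tendsto_inverse_0_at_top[OF filterlim_ident]
        tendsto_neg_powr[OF _ filterlim_ident] tendsto_intros) auto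
  then have "(U \<longlongrightarrow> M * K + B) at_top"
    by (simp add: K_def)
  moreover have "M * K + B < M * (K + B)"
    using \<open>M > 1\<close> \<open>B > 0\<close> by (simp add: distrib_left)
  ultimately have "eventually (\<lambda>r. U r < M * (K + B)) at_top"
    by (rule order_tendstoD(2))
  then show ?thesis
    using eventually_gt_at_top[of "R + d"]
  proof eventually_elim
    case (elim r)
    have r: "r > 0" "r > d" "r - d > R"
      using elim(2) \<open>R > 0\<close> \<open>d > 0\<close> by auto
    show ?case
    proof (intro allI impI)
      fix \<mu> \<phi>
      assume "EP_subsolution m b V (B * r powr (p + \<eta>)) \<mu> \<phi>"
      from C[OF this, of "r *\<^sub>R axis (undefined :: 'd) 1"] obtain x where
        near: "norm (x - r *\<^sub>R axis (undefined :: 'd) 1) \<le> d"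
        and \<mu>: "\<mu> \<le> C + M * (norm (b x) powr ms / ms) + B * r powr (p + \<eta>) * V x"
        by blast
      have "norm (r *\<^sub>R axis (undefined :: 'd) 1 :: real^'d) = r"
        using r by (simp add: norm_axis_1)
      then have lower: "r - d \<le> norm x" and upper: "norm x \<le> r + d"
        using near norm_triangle_ineq3[of x "r *\<^sub>R axis (undefined :: 'd) 1"] by linarith+
      then have out: "norm x \<ge> R" "norm x > 0"
        using r \<open>R > 0\<close> by auto
      have V_le: "V x \<le> (r - d) powr (- \<eta>)"
        using struct out lower r \<open>\<eta> > 0\<close>
        by (auto simp: structural_assumptions_def intro!: powr_mono2')
      have "norm (b x) = \<bar>\<rho> + a * inverse (norm x)\<bar> * norm x powr \<delta>"
        using struct out powr_add[of "norm x" "\<delta> - 1" 1]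
        by (auto simp: structural_assumptions_def abs_mult)
      also have "\<dots> \<le> (\<rho> + \<bar>a\<bar> * inverse (r - d)) * (r + d) powr \<delta>"
      proof (rule mult_mono)
        have "\<bar>a\<bar> * inverse (norm x) \<le> \<bar>a\<bar> * inverse (r - d)"
          using lower r by (intro mult_left_mono le_imp_inverse_le) auto
        moreover have "\<bar>\<rho> + a * inverse (norm x)\<bar> \<le> \<rho> + \<bar>a\<bar> * inverse (norm x)"
          using \<open>\<rho> > 0\<close> abs_triangle_ineq[of \<rho> "a * inverse (norm x)"] by (simp add: abs_mult)
        ultimately show "\<bar>\<rho> + a * inverse (norm x)\<bar> \<le> \<rho> + \<bar>a\<bar> * inverse (r - d)"
          by linarith
        show "norm x powr \<delta> \<le> (r + d) powr \<delta>"
          using upper \<open>\<delta> > 0\<close> by (intro powr_mono2) auto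
      qed (use \<open>\<rho> > 0\<close> r in auto)
      finally have "norm (b x) powr ms \<le> ((\<rho> + \<bar>a\<bar> * inverse (r - d)) * (r + d) powr \<delta>) powr ms"
        using \<open>ms > 1\<close> by (intro powr_mono2) auto
      also have "\<dots> = (\<rho> + \<bar>a\<bar> * inverse (r - d)) powr ms * (r + d) powr p"
        using \<open>\<rho> > 0\<close> r by (simp add: powr_mult powr_powr p_def)
      finally have b_le: "norm (b x) powr ms \<le> (\<rho> + \<bar>a\<bar> * inverse (r - d)) powr ms * (r + d) powr p" .
      have "\<mu> \<le> C + M * ((\<rho> + \<bar>a\<bar> * inverse (r - d)) powr ms * (r + d) powr p / ms)
          + B * r powr (p + \<eta>) * (r - d) powr (- \<eta>)"
        using b_le V_le \<open>M > 1\<close> \<open>ms > 1\<close> \<open>B > 0\<close>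
        by (intro order_trans[OF \<mu>] add_mono mult_left_mono divide_right_mono) auto
      also have "\<dots> = U r * r powr p"
      proof -
        have "r + d = (1 + d * inverse r) * r" "r - d = (1 - d * inverse r) * r"
          using r by (simp_all add: field_simps)
        then have plus: "(r + d) powr p = (1 + d * inverse r) powr p * r powr p"
          and minus: "(r - d) powr (- \<eta>) = (1 - d * inverse r) powr (- \<eta>) * r powr (- \<eta>)"
          by (simp_all only: powr_mult)
        have "r powr (p + \<eta>) * r powr (- \<eta>) = r powr p" "r powr (- p) * r powr p = 1"
          using r by (simp_all flip: powr_add)
        moreover have "(C * x + M * (A * P / ms) + B * Z) * y = C * (x * y) + M * (A * (P * y) / ms) + B * Z * y"
          for x y A P Z :: real
          by (simp add: algebra_simps)
        moreover have "B * r powr (p + \<eta>) * (Z * r powr (- \<eta>)) = B * Z * (r powr (p + \<eta>) * r powr (- \<eta>))" for Z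
          by simp
        ultimately show ?thesis
          unfolding plus minus U_def by (simp only: mult_1_right)
      qed
      also have "\<dots> \<le> M * (K + B) * r powr p"
        using elim(1) by (intro mult_right_mono) auto
      finally show "\<mu> \<le> M * ((K + B) * r powr p)"
        by (simp add: mult.assoc)
    qed
  qed
qed

section \<open>The asymptotics of the eigenvalue\<close>

theorem theorem3p1:
  fixes b :: "real^'d::finite \<Rightarrow> real^'d" and V :: "real^'d \<Rightarrow> real"
    and m ms \<delta> \<rho> R a \<eta> :: real
  assumes "m > 1" and "ms = m / (m - 1)"
    and "\<delta> > 0" and "\<rho> > 0" and "R > 0" and "\<eta> > 0"
    and "structural_assumptions \<delta> \<rho> R a \<eta> b V"
  shows "((\<lambda>\<beta>. ereal (\<beta> powr (- (\<delta> * ms / (\<delta> * ms + \<eta>)))) * lambda_max m b V \<beta>)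
           \<longlongrightarrow> ereal ((\<delta> * ms + \<eta>) / (\<delta> * ms)
                  * (\<rho> powr ms * \<delta> / \<eta>) powr (\<eta> / (\<delta> * ms + \<eta>)))) at_top"
proof -
  define p where "p = \<delta> * ms"
  define K where "K = \<rho> powr ms / ms"
  define B where "B = K * p / \<eta>"
  define \<theta> where "\<theta> = p / (p + \<eta>)"
  define L where "L = (K + B) * B powr (- \<theta>)"
  have "ms > 1"
    using assms(1) by (simp add: assms(2) field_simps)
  then have "p > 0" "K > 0"
    using assms by (simp_all add: p_def K_def)
  then have "B > 0"
    using \<open>\<eta> > 0\<close> by (simp add: B_def)
  have "L > 0"
    using \<open>K > 0\<close> \<open>B > 0\<close> by (simp add: L_def)
  have L_eq: "L = (p + \<eta>) / p * (\<rho> powr ms * \<delta> / \<eta>) powr (\<eta> / (p + \<eta>))"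
  proof -
    have B_eq: "B = \<rho> powr ms * \<delta> / \<eta>"
      using \<open>ms > 1\<close> by (simp add: B_def K_def p_def)
    have "K + B = (p + \<eta>) / p * B"
      using \<open>p > 0\<close> \<open>\<eta> > 0\<close> by (simp add: B_def field_simps)
    moreover have "B * B powr (- \<theta>) = B powr (\<eta> / (p + \<eta>))"
    proof -
      have "1 - \<theta> = \<eta> / (p + \<eta>)"
        using \<open>p > 0\<close> \<open>\<eta> > 0\<close> by (simp add: \<theta>_def field_simps)
      then show ?thesis
        using \<open>B > 0\<close> powr_add[of B 1 "- \<theta>"] by simp
    qed
    ultimately show ?thesis
      unfolding L_def B_eq[symmetric] by (simp only: mult.assoc)
  qed
  \<comment> \<open>\<open>\<beta> r\<close> is the value of the parameter for which the effective potential is minimal at distance \<open>r\<close>.\<close>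
  define \<beta> where "\<beta> = (\<lambda>r. B * r powr (p + \<eta>))"
  define Q where "Q = (\<lambda>\<beta>. ereal (\<beta> powr (- \<theta>)) * lambda_max m b V \<beta>)"
  have scale: "\<beta> r powr (- \<theta>) * (k * ((K + B) * r powr p)) = k * L" if "r > 0" for r k
  proof -
    have "(p + \<eta>) * - \<theta> = - p"
      using \<open>p > 0\<close> \<open>\<eta> > 0\<close> by (simp add: \<theta>_def)
    then have "\<beta> r powr (- \<theta>) = B powr (- \<theta>) * r powr (- p)"
      unfolding \<beta>_def powr_mult powr_powr by (simp only:)
    moreover have "r powr (- p) * r powr p = 1"
      using that by (simp flip: powr_add)
    ultimately show ?thesis
      by (simp add: L_def)
  qed
  have lower: "eventually (\<lambda>r. ereal (\<kappa> * L) \<le> Q (\<beta> r)) at_top" if "0 < \<kappa>" "\<kappa> < 1" for \<kappa>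
    using exists_near_optimal_subsolution[OF assms that] eventually_gt_at_top[of 0]
    unfolding p_def[symmetric] K_def[symmetric] B_def[symmetric]
  proof eventually_elim
    case (elim r)
    then have "ereal (\<kappa> * ((K + B) * r powr p)) \<le> lambda_max m b V (\<beta> r)"
      unfolding lambda_max_def \<beta>_def by (intro Sup_upper) blast
    then have "ereal (\<beta> r powr (- \<theta>)) * ereal (\<kappa> * ((K + B) * r powr p)) \<le> Q (\<beta> r)"
      unfolding Q_def by (intro ereal_mult_left_mono) auto
    then show ?case
      by (simp add: scale[OF elim(2)])
  qed
  have upper: "eventually (\<lambda>r. Q (\<beta> r) \<le> ereal (M * L)) at_top" if "M > 1" for M
    using subsolution_level_upper_bound[OF assms that] eventually_gt_at_top[of 0]
    unfolding p_def[symmetric] K_def[symmetric] B_def[symmetric]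
  proof eventually_elim
    case (elim r)
    then have "lambda_max m b V (\<beta> r) \<le> ereal (M * ((K + B) * r powr p))"
      unfolding lambda_max_def \<beta>_def by (intro Sup_least) auto
    then have "Q (\<beta> r) \<le> ereal (\<beta> r powr (- \<theta>)) * ereal (M * ((K + B) * r powr p))"
      unfolding Q_def by (intro ereal_mult_left_mono) auto
    then show ?case
      by (simp add: scale[OF elim(2)])
  qed
  have lim: "((\<lambda>r. Q (\<beta> r)) \<longlongrightarrow> ereal L) at_top"
  proof (rule order_tendstoI)
    fix y assume "y < ereal L"
    then obtain z where z: "y < ereal z" "z < L"
      using ereal_dense2[of y "ereal L"] by auto
    define \<kappa> where "\<kappa> = max (1/2) (z / L)"
    have "0 < \<kappa>" "\<kappa> < 1" and "z \<le> \<kappa> * L"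
      using z \<open>L > 0\<close> by (auto simp: \<kappa>_def max_def field_simps)
    from \<open>0 < \<kappa>\<close> \<open>\<kappa> < 1\<close> show "eventually (\<lambda>r. y < Q (\<beta> r)) at_top"
    proof (rule eventually_mono[OF lower])
      fix r assume "ereal (\<kappa> * L) \<le> Q (\<beta> r)"
      moreover have "ereal z \<le> ereal (\<kappa> * L)"
        using \<open>z \<le> \<kappa> * L\<close> by simp
      ultimately show "y < Q (\<beta> r)"
        using z(1) by order
    qed
  next
    fix y assume "ereal L < y"
    then obtain z where z: "ereal z < y" "L < z"
      using ereal_dense2[of "ereal L" y] by auto
    have "z / L > 1" and "z / L * L = z"
      using z \<open>L > 0\<close> by simp_all
    from upper[OF \<open>z / L > 1\<close>] show "eventually (\<lambda>r. Q (\<beta> r) < y) at_top"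
    proof (rule eventually_mono)
      fix r assume "Q (\<beta> r) \<le> ereal (z / L * L)"
      then show "Q (\<beta> r) < y"
        unfolding \<open>z / L * L = z\<close> using z(1) by order
    qed
  qed
  \<comment> \<open>Returning from the optimal radius to the parameter by inverting \<open>\<beta>\<close>.\<close>
  define r where "r = (\<lambda>t. (t / B) powr (1 / (p + \<eta>)))"
  have "filterlim r at_top at_top"
    unfolding filterlim_at_top
  proof
    fix N
    have "N \<le> r t" if "t > B * max N 1 powr (p + \<eta>)" for t
    proof -
      have "max N 1 = (max N 1 powr (p + \<eta>)) powr (1 / (p + \<eta>))"
        using \<open>p > 0\<close> \<open>\<eta> > 0\<close> by (simp add: powr_powr)
      also have "\<dots> \<le> r t"
        unfolding r_def using that \<open>p > 0\<close> \<open>\<eta> > 0\<close> \<open>B > 0\<close>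
        by (intro powr_mono2) (auto simp: pos_le_divide_eq mult.commute)
      finally show ?thesis by simp
    qed
    then show "eventually (\<lambda>t. N \<le> r t) at_top"
      using eventually_gt_at_top by (rule eventually_mono[rotated])
  qed
  from filterlim_compose[OF lim this] have "((\<lambda>t. Q (\<beta> (r t))) \<longlongrightarrow> ereal L) at_top" .
  moreover have "eventually (\<lambda>t. Q (\<beta> (r t)) = Q t) at_top"
    using eventually_gt_at_top[of 0]
  proof eventually_elim
    case (elim t)
    have "\<beta> (r t) = t"
      using elim \<open>B > 0\<close> \<open>p > 0\<close> \<open>\<eta> > 0\<close> by (simp add: \<beta>_def r_def powr_powr)
    then show ?case by simp
  qed
  ultimately have "(Q \<longlongrightarrow> ereal L) at_top"
    by (rule Lim_transform_eventually)
  then show ?thesis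
    unfolding Q_def L_eq \<theta>_def p_def .
qed

end
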